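(* Let $\mathcal{A}$ be an abelian category with all small products and coproducts, let $\mathcal{C}$ be a class of objects of $\mathcal{A}$, and suppose that $\mathcal{A}$ is $\prod\mathcal{C}$-compactly generated. Assume that there is no strongly inaccessible cardinal. Then for every family $\mathcal{M}$ of $\mathcal{C}$-compact objects of $\mathcal{A}$ the product $\prod\mathcal{M}$ is $\mathcal{C}$-compact.
   Context: A family (or system) of objects is a set-indexed family; repetitions are allowed. $\mathcal{A}(X,Y)$ denotes the abelian group of morphisms $X\to Y$. For a family $\mathcal{N}$ of objects, $\nu_N: N\to\bigoplus\mathcal{N}$ ($N\in\mathcal{N}$) are the structural morphisms of the coproduct. For an object $M$, there is the canonical (injective) group homomorphism $$\Psi_{\mathcal{N}}:\bigoplus_{N\in\mathcal{N}}\mathcal{A}(M,N)\to\mathcal{A}\Big(M,\bigoplus\mathcal{N}\Big),\qquad (\varphi_N)_N\mapsto\sum_N \nu_N\circ\varphi_N$$ (a finite sum). The object $M$ is $\mathcal{C}$-compact if $\Psi_{\mathcal{N}}$ is an isomorphism for every family $\mathcal{N}$ of objects of $\mathcal{C}$. $\mathcal{A}$ is $\prod\mathcal{C}$-compactly generated if there is a set $\mathcal{G}$ of objects of $\mathcal{A}$ that generates $\mathcal{A}$ (every object is an epimorphic image of a coproduct of a family of objects of $\mathcal{G}$) and such that the product of any system of objects of $\mathcal{G}$ is $\mathcal{C}$-compact. A strongly inaccessible cardinal is an uncountable regular cardinal $\kappa$ with $2^\lambda<\kappa$ for each $\lambda<\kappa$. *)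

theory Defs
  imports "HOL-Algebra.Free_Abelian_Groups"
begin

unbundle cardinal_syntax

text \<open>
  Size convention. The type \<open>'u\<close> plays the role of the set-theoretic universe: a ``set'' (as opposed
  to a class) is a collection of cardinality strictly below that of \<open>'u\<close>, so that every set is
  equipotent with a small subset of \<open>'u\<close> and set-indexed families can be indexed by small subsets of
  \<open>'u\<close>. If the cardinality of \<open>'u\<close> is strongly inaccessible, this is smallness relative to a
  Grothendieck universe. Neither closure properties of \<open>'u\<close> nor smallness of the groups of morphisms
  are assumed anywhere.
\<close>

definition small :: "'u itself \<Rightarrow> 'b set \<Rightarrow> bool" where
  "small _ S \<longleftrightarrow> |S| <o |UNIV :: 'u set|"

definition strongly_inaccessible :: "'u rel \<Rightarrow> bool" where
  "strongly_inaccessible \<kappa> \<longleftrightarrow>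
     Card_order \<kappa> \<and> natLeq <o \<kappa> \<and> regularCard \<kappa> \<and>
     (\<forall>\<mu> :: 'u rel. Card_order \<mu> \<and> \<mu> <o \<kappa> \<longrightarrow> ctwo ^c \<mu> <o \<kappa>)"

text \<open>
  Categories enriched in abelian groups. The group of morphisms from \<open>X\<close> to \<open>Y\<close> is written
  multiplicatively, because it is a \<open>comm_group\<close> in the sense of HOL-Algebra: \<open>\<otimes>\<close> is the addition of
  morphisms and \<open>\<one>\<close> the zero morphism. Hom sets for different pairs of objects may overlap, so that
  being mono, epi, a kernel etc. is relative to the source and target, which are passed explicitly.
\<close>

record ('o, 'm) hom_cat =
  Obj :: "'o set"
  Hom :: "'o \<Rightarrow> 'o \<Rightarrow> 'm monoid"
  ident :: "'o \<Rightarrow> 'm"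
  cmp :: "'m \<Rightarrow> 'm \<Rightarrow> 'm"  (infixl \<open>\<cdot>\<index>\<close> 75)

abbreviation Mor :: "('o, 'm) hom_cat \<Rightarrow> 'o \<Rightarrow> 'o \<Rightarrow> 'm set" where
  "Mor A X Y \<equiv> carrier (Hom A X Y)"

abbreviation zero_mor :: "('o, 'm) hom_cat \<Rightarrow> 'o \<Rightarrow> 'o \<Rightarrow> 'm" where
  "zero_mor A X Y \<equiv> \<one>\<^bsub>Hom A X Y\<^esub>"

locale preadditive_category =
  fixes A :: "('o, 'm) hom_cat" (structure)
  assumes Hom_comm_group: "\<lbrakk>X \<in> Obj A; Y \<in> Obj A\<rbrakk> \<Longrightarrow> comm_group (Hom A X Y)"
    and ident_mor: "X \<in> Obj A \<Longrightarrow> ident A X \<in> Mor A X X"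
    and cmp_mor: "\<lbrakk>X \<in> Obj A; Y \<in> Obj A; Z \<in> Obj A; f \<in> Mor A X Y; g \<in> Mor A Y Z\<rbrakk>
          \<Longrightarrow> g \<cdot> f \<in> Mor A X Z"
    and cmp_assoc: "\<lbrakk>W \<in> Obj A; X \<in> Obj A; Y \<in> Obj A; Z \<in> Obj A;
            f \<in> Mor A W X; g \<in> Mor A X Y; h \<in> Mor A Y Z\<rbrakk>
          \<Longrightarrow> (h \<cdot> g) \<cdot> f = h \<cdot> (g \<cdot> f)"
    and cmp_ident_left: "\<lbrakk>X \<in> Obj A; Y \<in> Obj A; f \<in> Mor A X Y\<rbrakk> \<Longrightarrow> ident A Y \<cdot> f = f"
    and cmp_ident_right: "\<lbrakk>X \<in> Obj A; Y \<in> Obj A; f \<in> Mor A X Y\<rbrakk> \<Longrightarrow> f \<cdot> ident A X = f"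
    and cmp_add_right: "\<lbrakk>X \<in> Obj A; Y \<in> Obj A; Z \<in> Obj A;
            f \<in> Mor A X Y; f' \<in> Mor A X Y; g \<in> Mor A Y Z\<rbrakk>
          \<Longrightarrow> g \<cdot> (f \<otimes>\<^bsub>Hom A X Y\<^esub> f') = (g \<cdot> f) \<otimes>\<^bsub>Hom A X Z\<^esub> (g \<cdot> f')"
    and cmp_add_left: "\<lbrakk>X \<in> Obj A; Y \<in> Obj A; Z \<in> Obj A;
            f \<in> Mor A X Y; g \<in> Mor A Y Z; g' \<in> Mor A Y Z\<rbrakk>
          \<Longrightarrow> (g \<otimes>\<^bsub>Hom A Y Z\<^esub> g') \<cdot> f = (g \<cdot> f) \<otimes>\<^bsub>Hom A X Z\<^esub> (g' \<cdot> f)"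

definition is_monomorphism :: "('o, 'm) hom_cat \<Rightarrow> 'o \<Rightarrow> 'o \<Rightarrow> 'm \<Rightarrow> bool" where
  "is_monomorphism A X Y f \<longleftrightarrow> f \<in> Mor A X Y \<and>
     (\<forall>W \<in> Obj A. \<forall>g \<in> Mor A W X. \<forall>h \<in> Mor A W X. f \<cdot>\<^bsub>A\<^esub> g = f \<cdot>\<^bsub>A\<^esub> h \<longrightarrow> g = h)"

definition is_epimorphism :: "('o, 'm) hom_cat \<Rightarrow> 'o \<Rightarrow> 'o \<Rightarrow> 'm \<Rightarrow> bool" where
  "is_epimorphism A X Y f \<longleftrightarrow> f \<in> Mor A X Y \<and>
     (\<forall>W \<in> Obj A. \<forall>g \<in> Mor A Y W. \<forall>h \<in> Mor A Y W. g \<cdot>\<^bsub>A\<^esub> f = h \<cdot>\<^bsub>A\<^esub> f \<longrightarrow> g = h)"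

definition is_zero_object :: "('o, 'm) hom_cat \<Rightarrow> 'o \<Rightarrow> bool" where
  "is_zero_object A Z \<longleftrightarrow> Z \<in> Obj A \<and>
     (\<forall>X \<in> Obj A. (\<exists>!f. f \<in> Mor A X Z) \<and> (\<exists>!f. f \<in> Mor A Z X))"

definition is_kernel :: "('o, 'm) hom_cat \<Rightarrow> 'o \<Rightarrow> 'o \<Rightarrow> 'm \<Rightarrow> 'o \<Rightarrow> 'm \<Rightarrow> bool" where
  "is_kernel A X Y f K k \<longleftrightarrow> K \<in> Obj A \<and> k \<in> Mor A K X \<and> f \<cdot>\<^bsub>A\<^esub> k = zero_mor A K Y \<and>
     (\<forall>W \<in> Obj A. \<forall>g \<in> Mor A W X. f \<cdot>\<^bsub>A\<^esub> g = zero_mor A W Y \<longrightarrow>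
        (\<exists>!u. u \<in> Mor A W K \<and> k \<cdot>\<^bsub>A\<^esub> u = g))"

definition is_cokernel :: "('o, 'm) hom_cat \<Rightarrow> 'o \<Rightarrow> 'o \<Rightarrow> 'm \<Rightarrow> 'o \<Rightarrow> 'm \<Rightarrow> bool" where
  "is_cokernel A X Y f Q q \<longleftrightarrow> Q \<in> Obj A \<and> q \<in> Mor A Y Q \<and> q \<cdot>\<^bsub>A\<^esub> f = zero_mor A X Q \<and>
     (\<forall>W \<in> Obj A. \<forall>g \<in> Mor A Y W. g \<cdot>\<^bsub>A\<^esub> f = zero_mor A X W \<longrightarrow>
        (\<exists>!u. u \<in> Mor A Q W \<and> u \<cdot>\<^bsub>A\<^esub> q = g))"

text \<open>
  \<open>P\<close> with projections \<open>\<pi> i\<close> is a product, respectively \<open>S\<close> with structural morphisms \<open>\<nu> i\<close> is a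
  coproduct, of the family \<open>(N i)\<close>, \<open>i \<in> I\<close>.
\<close>

definition is_product ::
    "('o, 'm) hom_cat \<Rightarrow> 'i set \<Rightarrow> ('i \<Rightarrow> 'o) \<Rightarrow> 'o \<Rightarrow> ('i \<Rightarrow> 'm) \<Rightarrow> bool" where
  "is_product A I N P \<pi> \<longleftrightarrow> P \<in> Obj A \<and> (\<forall>i \<in> I. \<pi> i \<in> Mor A P (N i)) \<and>
     (\<forall>W \<in> Obj A. \<forall>f. (\<forall>i \<in> I. f i \<in> Mor A W (N i)) \<longrightarrow>
        (\<exists>!u. u \<in> Mor A W P \<and> (\<forall>i \<in> I. \<pi> i \<cdot>\<^bsub>A\<^esub> u = f i)))"

definition is_coproduct ::
    "('o, 'm) hom_cat \<Rightarrow> 'i set \<Rightarrow> ('i \<Rightarrow> 'o) \<Rightarrow> 'o \<Rightarrow> ('i \<Rightarrow> 'm) \<Rightarrow> bool" where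
  "is_coproduct A I N S \<nu> \<longleftrightarrow> S \<in> Obj A \<and> (\<forall>i \<in> I. \<nu> i \<in> Mor A (N i) S) \<and>
     (\<forall>W \<in> Obj A. \<forall>f. (\<forall>i \<in> I. f i \<in> Mor A (N i) W) \<longrightarrow>
        (\<exists>!u. u \<in> Mor A S W \<and> (\<forall>i \<in> I. u \<cdot>\<^bsub>A\<^esub> \<nu> i = f i)))"

locale abelian_category = preadditive_category A for A :: "('o, 'm) hom_cat" (structure) +
  assumes zero_object_exists: "\<exists>Z. is_zero_object A Z"
    and binary_product_exists:
      "N \<in> UNIV \<rightarrow> Obj A \<Longrightarrow> \<exists>P \<pi>. is_product A (UNIV :: bool set) N P \<pi>"
    and binary_coproduct_exists:
      "N \<in> UNIV \<rightarrow> Obj A \<Longrightarrow> \<exists>S \<nu>. is_coproduct A (UNIV :: bool set) N S \<nu>"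
    and kernel_exists:
      "\<lbrakk>X \<in> Obj A; Y \<in> Obj A; f \<in> Mor A X Y\<rbrakk> \<Longrightarrow> \<exists>K k. is_kernel A X Y f K k"
    and cokernel_exists:
      "\<lbrakk>X \<in> Obj A; Y \<in> Obj A; f \<in> Mor A X Y\<rbrakk> \<Longrightarrow> \<exists>Q q. is_cokernel A X Y f Q q"
    and mono_is_kernel:
      "\<lbrakk>X \<in> Obj A; Y \<in> Obj A; is_monomorphism A X Y f\<rbrakk>
        \<Longrightarrow> \<exists>Z \<in> Obj A. \<exists>g \<in> Mor A Y Z. is_kernel A Y Z g X f"
    and epi_is_cokernel:
      "\<lbrakk>X \<in> Obj A; Y \<in> Obj A; is_epimorphism A X Y f\<rbrakk>
        \<Longrightarrow> \<exists>Z \<in> Obj A. \<exists>g \<in> Mor A Z X. is_cokernel A Z X g Y f"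

definition has_small_products :: "'u itself \<Rightarrow> ('o, 'm) hom_cat \<Rightarrow> bool" where
  "has_small_products U A \<longleftrightarrow>
     (\<forall>(I :: 'u set) N. small U I \<and> N \<in> I \<rightarrow> Obj A \<longrightarrow> (\<exists>P \<pi>. is_product A I N P \<pi>))"

definition has_small_coproducts :: "'u itself \<Rightarrow> ('o, 'm) hom_cat \<Rightarrow> bool" where
  "has_small_coproducts U A \<longleftrightarrow>
     (\<forall>(I :: 'u set) N. small U I \<and> N \<in> I \<rightarrow> Obj A \<longrightarrow> (\<exists>S \<nu>. is_coproduct A I N S \<nu>))"

text \<open>
  The canonical homomorphism from the direct sum of the groups \<open>Hom A M (N i)\<close> to \<open>Hom A M S\<close>, where
  \<open>S\<close> is a coproduct of the \<open>N i\<close> with structural morphisms \<open>\<nu> i\<close>; \<open>gfinprod\<close> is the (finite) sum of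
  the nonzero terms in the multiplicatively written group \<open>Hom A M S\<close>.
\<close>

definition Psi ::
    "('o, 'm) hom_cat \<Rightarrow> 'o \<Rightarrow> 'i set \<Rightarrow> 'o \<Rightarrow> ('i \<Rightarrow> 'm) \<Rightarrow> ('i \<Rightarrow> 'm) \<Rightarrow> 'm" where
  "Psi A M I S \<nu> \<phi> = gfinprod (Hom A M S) (\<lambda>i. \<nu> i \<cdot>\<^bsub>A\<^esub> \<phi> i) I"

text \<open>
  Products and coproducts are not chosen; the definitions below quantify over all of them. Since they
  are unique up to isomorphism, the choice does not matter.
\<close>

definition compact_wrt :: "'u itself \<Rightarrow> ('o, 'm) hom_cat \<Rightarrow> 'o set \<Rightarrow> 'o \<Rightarrow> bool" where
  "compact_wrt U A C M \<longleftrightarrow> M \<in> Obj A \<and>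
     (\<forall>(I :: 'u set) N S \<nu>. small U I \<and> N \<in> I \<rightarrow> C \<and> is_coproduct A I N S \<nu> \<longrightarrow>
        Psi A M I S \<nu> \<in> iso (sum_group I (\<lambda>i. Hom A M (N i))) (Hom A M S))"

definition generates :: "'u itself \<Rightarrow> ('o, 'm) hom_cat \<Rightarrow> 'o set \<Rightarrow> bool" where
  "generates U A G \<longleftrightarrow>
     (\<forall>X \<in> Obj A. \<exists>(I :: 'u set) N S \<nu> e. small U I \<and> N \<in> I \<rightarrow> G \<and>
        is_coproduct A I N S \<nu> \<and> is_epimorphism A S X e)"

definition prod_compactly_generated ::
    "'u itself \<Rightarrow> ('o, 'm) hom_cat \<Rightarrow> 'o set \<Rightarrow> bool" where
  "prod_compactly_generated U A C \<longleftrightarrow>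
     (\<exists>G \<subseteq> Obj A. small U G \<and> generates U A G \<and>
        (\<forall>(I :: 'u set) N P \<pi>. small U I \<and> N \<in> I \<rightarrow> G \<and> is_product A I N P \<pi> \<longrightarrow>
           compact_wrt U A C P))"

end

theory Submission
  imports Defs "HOL-Library.Countable_Set"
begin

text \<open>
  Let \<open>f\<close> be a morphism from a product \<open>P\<close> of compact objects to a coproduct \<open>S\<close>. A coproduct need
  not embed in the product, but since the generators are compact, a morphism to \<open>S\<close> whose components
  all vanish is zero, and an object is compact iff every morphism from it to such an \<open>S\<close> has finitely
  many nonzero components. Call a set \<open>T\<close> of indices of \<open>P\<close> null if \<open>f\<close>, composed with the
  truncation of \<open>P\<close> to \<open>T\<close>, has finitely many nonzero components. The null sets form an ideal, and
  a gliding hump argument with products of generators shows that a point-finite sequence of sets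
  contains a null set. Hence the ideal is countably complete and, if it is proper, has an atom, which
  yields a nontrivial countably complete ultrafilter and so a measurable, in particular strongly
  inaccessible, cardinal.
\<close>

section \<open>Countably complete ideals and measurable cardinals\<close>

text \<open>\<open>J\<close> is an ideal containing all points of \<open>K\<close>; its members need
  not lie in \<open>K\<close>. The last axiom takes the place of countable completeness, which
  follows from it, and also forbids infinite sequences of pairwise disjoint subsets of
  \<open>K\<close> outside \<open>J\<close>.\<close>

locale gliding_ideal =
  fixes K :: "'a set" and J :: "'a set set"
  assumes null_subset: "A \<in> J \<Longrightarrow> B \<subseteq> A \<Longrightarrow> B \<in> J"
    and null_Un: "A \<in> J \<Longrightarrow> B \<in> J \<Longrightarrow> A \<union> B \<in> J"
    and null_singleton: "k \<in> K \<Longrightarrow> {k} \<in> J"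
    and null_point_finite:
      "\<lbrakk>\<And>n. T n \<subseteq> K; \<And>k. finite {n :: nat. k \<in> T n}\<rbrakk> \<Longrightarrow> \<exists>n. T n \<in> J"
begin

lemma null_empty: "{} \<in> J"
  using null_point_finite[of "\<lambda>_. {}"] by auto

lemma null_finite_UN:
  assumes "finite F" "\<And>n. n \<in> F \<Longrightarrow> A n \<in> J"
  shows "(\<Union>n\<in>F. A n) \<in> J"
  using assms by (induction rule: finite_induct) (auto intro: null_empty null_Un)

text \<open>The remainders \<open>?T m\<close> left after removing the first \<open>m\<close> sets
  are point-finite, since a point of \<open>A n\<close> lies in no \<open>?T m\<close> with
  \<open>m > n\<close>. So some remainder is null, and only a finite union is missing from
  it.\<close>

lemma null_UN_nat:
  assumes "\<And>n :: nat. A n \<in> J" "\<And>n. A n \<subseteq> K"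
  shows "(\<Union>n. A n) \<in> J"
proof -
  let ?T = "\<lambda>m. (\<Union>n. A n) - (\<Union>n<m. A n)"
  have "finite {m. k \<in> ?T m}" for k
  proof (cases "\<exists>n. k \<in> A n")
    case True
    then obtain n where "k \<in> A n" by blast
    then have "{m. k \<in> ?T m} \<subseteq> {..n}" by (auto simp: not_less[symmetric])
    then show ?thesis by (rule finite_subset) simp
  qed auto
  then obtain m where "?T m \<in> J"
    using null_point_finite[of ?T] assms(2) by blast
  moreover have "(\<Union>n<m. A n) \<in> J" by (rule null_finite_UN) (auto simp: assms)
  ultimately have "?T m \<union> (\<Union>n<m. A n) \<in> J" by (rule null_Un)
  then show ?thesis by (rule null_subset) blast
qed

lemma null_UN_countable:
  assumes "countable L" "\<And>l. l \<in> L \<Longrightarrow> A l \<in> J" "\<And>l. l \<in> L \<Longrightarrow> A l \<subseteq> K"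
  shows "(\<Union>l\<in>L. A l) \<in> J"
proof (cases "L = {}")
  case False
  then have "range (from_nat_into L) = L" using assms(1) by (rule range_from_nat_into)
  then have "(\<Union>l\<in>L. A l) = (\<Union>n. A (from_nat_into L n))" by (metis image_image)
  also have "\<dots> \<in> J"
    by (rule null_UN_nat) (simp_all add: assms False from_nat_into)
  finally show ?thesis .
qed (simp add: null_empty)

text \<open>Without an atom every non-null subset of \<open>K\<close> splits into two non-null
  parts. Iterating yields a decreasing sequence whose successive differences are non-null and
  pairwise disjoint, hence point-finite.\<close>

lemma atom_exists:
  assumes "K \<notin> J"
  shows "\<exists>X \<subseteq> K. X \<notin> J \<and> (\<forall>Y \<subseteq> X. Y \<in> J \<or> X - Y \<in> J)"
proof (rule ccontr)
  assume neg: "\<not> ?thesis"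
  have split: "\<exists>Y \<subseteq> X. Y \<notin> J \<and> X - Y \<notin> J" if "X \<subseteq> K" "X \<notin> J" for X
    using neg that by blast
  have "\<exists>f. \<forall>n. (f n \<subseteq> K \<and> f n \<notin> J) \<and> (f (Suc n) \<subseteq> f n \<and> f n - f (Suc n) \<notin> J)"
  proof (rule dependent_nat_choice)
    show "\<exists>Y. Y \<subseteq> K \<and> Y \<notin> J" using assms by blast
    fix Y and n :: nat
    assume "Y \<subseteq> K \<and> Y \<notin> J"
    then obtain Z where "Z \<subseteq> Y" "Z \<notin> J" "Y - Z \<notin> J" using split by blast
    then show "\<exists>Z. (Z \<subseteq> K \<and> Z \<notin> J) \<and> (Z \<subseteq> Y \<and> Y - Z \<notin> J)"
      using \<open>Y \<subseteq> K \<and> Y \<notin> J\<close> by blast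
  qed
  then obtain f where f: "\<And>n. f n \<subseteq> K" "\<And>n. f (Suc n) \<subseteq> f n" "\<And>n. f n - f (Suc n) \<notin> J"
    by blast
  have dec: "f n \<subseteq> f m" if "m \<le> n" for m n
    using that by (rule lift_Suc_antimono_le[rotated]) (rule f(2))
  have "m = n" if "k \<in> f m - f (Suc m)" "k \<in> f n - f (Suc n)" for k m n
    using that dec[of "Suc m" n] dec[of "Suc n" m] by (cases m n rule: linorder_cases) auto
  then have "is_singleton {n. k \<in> f n - f (Suc n)} \<or> {n. k \<in> f n - f (Suc n)} = {}" for k
    unfolding is_singleton_def by blast
  then have "finite {n. k \<in> f n - f (Suc n)}" for k
    by (metis finite.emptyI finite_insert is_singletonE)
  then show False using null_point_finite[of "\<lambda>n. f n - f (Suc n)"] f by blast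
qed

text \<open>
  Ulam's argument: the least number of null sets that cover an atom is a measurable cardinal. It is
  a strong limit because a point of the atom is determined by its bits, and for each of fewer than
  \<open>\<kappa>\<close> bits one value is taken almost everywhere.
\<close>

theorem strongly_inaccessible_exists:
  assumes "K \<notin> J"
  shows "\<exists>\<kappa> :: 'a rel. strongly_inaccessible \<kappa> \<and> \<kappa> \<le>o |K|"
proof -
  obtain X where X: "X \<subseteq> K" "X \<notin> J" and prime: "\<forall>Y \<subseteq> X. Y \<in> J \<or> X - Y \<in> J"
    using atom_exists[OF assms] by (elim exE conjE)
  let ?fib = "\<lambda>g B. {x \<in> X. g x \<in> B}"
  \<comment> \<open>A map from \<open>X\<close> to \<open>L\<close> with null fibres presents
    \<open>X\<close> as a disjoint union of null sets indexed by \<open>L\<close>; \<open>?R\<close>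
    collects the sizes of such index sets.\<close>
  let ?R = "{|L| | L :: 'a set. \<exists>g. g \<in> X \<rightarrow> L \<and> (\<forall>l \<in> L. ?fib g {l} \<in> J)}"
  \<comment> \<open>The identity has singleton fibres, so \<open>?R\<close> is nonempty and its
    least element is bounded by \<open>|X|\<close>, hence by \<open>|K|\<close>.\<close>
  have "?fib id {l} \<in> J" if "l \<in> X" for l
    by (rule null_subset[OF null_singleton[of l]]) (use that X in auto)
  then have XR: "|X| \<in> ?R" by (intro CollectI exI[of _ X] conjI exI[of _ id]) auto
  moreover have "\<forall>r \<in> ?R. Card_order r" using card_of_Card_order by auto
  ultimately have "\<exists>r \<in> ?R. \<forall>r' \<in> ?R. r \<le>o r'" 
    by (intro exists_minim_Card_order) (rule ex_in_conv[THEN iffD1], rule exI)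
  then obtain \<kappa> where \<kappa>: "\<kappa> \<in> ?R" and least: "\<And>r. r \<in> ?R \<Longrightarrow> \<kappa> \<le>o r" by auto
  from \<kappa> obtain L g where L: "\<kappa> = |L|" "g \<in> X \<rightarrow> L" and fib: "\<And>l. l \<in> L \<Longrightarrow> ?fib g {l} \<in> J"
    by auto
  have \<kappa>K: "\<kappa> \<le>o |K|"
    using least[OF XR] card_of_mono1[OF X(1)] ordLeq_transitive by blast
  have whole: "?fib g L \<notin> J"
  proof -
    have "?fib g L = X" using L by auto
    then show ?thesis using X by simp
  qed
  \<comment> \<open>The null ideal pushed forward along \<open>g\<close> is prime on
    \<open>L\<close>, because complementary subsets of \<open>L\<close> have complementary preimages
    in the atom \<open>X\<close>.\<close>
  have compl: "?fib g B \<in> J \<or> ?fib g (L - B) \<in> J" for B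
  proof -
    have "X - ?fib g B = ?fib g (L - B)" using L by auto
    then show ?thesis using prime[rule_format, of "?fib g B"] by auto
  qed
  \<comment> \<open>Minimality of \<open>\<kappa>\<close> makes the pushed-forward ideal closed
    under unions of fewer than \<open>\<kappa>\<close> sets: a counterexample would give a map from
    \<open>X\<close> to \<open>\<Lambda>\<close> with null fibres.\<close>
  have complete: "?fib g (\<Union>l\<in>\<Lambda>. B l) \<in> J"
    if \<Lambda>: "|\<Lambda>| <o |L|" and B: "\<And>l. l \<in> \<Lambda> \<Longrightarrow> ?fib g (B l) \<in> J" for \<Lambda> :: "'a set" and B
  proof (rule ccontr)
    let ?U = "\<Union>l\<in>\<Lambda>. B l"
    assume U: "?fib g ?U \<notin> J"
    then obtain l0 where l0: "l0 \<in> \<Lambda>" using null_empty by fastforce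
    define c where "c y = (SOME l. l \<in> \<Lambda> \<and> y \<in> B l)" for y
    have c: "c y \<in> \<Lambda> \<and> y \<in> B (c y)" if "y \<in> ?U" for y
      unfolding c_def by (rule someI_ex) (use that in auto)
    \<comment> \<open>Points whose image lies outside \<open>?U\<close> form a null set by
      primeness, so sending them all to the arbitrary index \<open>l0\<close> keeps the fibres
      null.\<close>
    let ?g = "\<lambda>x. if g x \<in> ?U then c (g x) else l0"
    have "?fib ?g {l} \<in> J" if "l \<in> \<Lambda>" for l
    proof (rule null_subset)
      show "?fib g (B l) \<union> ?fib g (L - ?U) \<in> J"
        using B[OF that] compl[of ?U] U by (blast intro: null_Un)
      show "?fib ?g {l} \<subseteq> ?fib g (B l) \<union> ?fib g (L - ?U)"
        using c L(2) by (fastforce split: if_splits)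
    qed
    moreover have "?g \<in> X \<rightarrow> \<Lambda>" using c l0 by auto
    ultimately have "|\<Lambda>| \<in> ?R" by blast
    then have "|L| \<le>o |\<Lambda>|" unfolding L(1)[symmetric] by (rule least)
    then show False using \<Lambda> not_ordLess_ordLeq by blast
  qed
  have small_null: "?fib g B \<in> J" if "|B| <o |L|" "B \<subseteq> L" for B
    using complete[OF that(1), of "\<lambda>l. {l}"] fib that(2) by (simp add: subset_iff)
  \<comment> \<open>Otherwise \<open>X\<close> would be a countable union of null fibres.\<close>
  have "natLeq <o \<kappa>"
  proof (rule ccontr)
    assume "\<not> natLeq <o \<kappa>"
    then have "|L| \<le>o natLeq"
      unfolding L(1) using ordLess_or_ordLeq[OF natLeq_Well_order card_of_Well_order] by blast
    then have "|L| \<le>o |UNIV :: nat set|"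
      by (rule ordLeq_ordIso_trans[OF _ ordIso_symmetric[OF card_of_nat]])
    then have "countable L" unfolding card_of_ordLeq[symmetric] countable_def by blast
    then have "(\<Union>l\<in>L. ?fib g {l}) \<in> J" by (rule null_UN_countable) (use fib X in auto)
    moreover have "(\<Union>l\<in>L. ?fib g {l}) = ?fib g L" by blast
    ultimately show False using whole by simp
  qed
  moreover have "regularCard \<kappa>"
    unfolding regularCard_def
  proof (intro allI impI, elim conjE)
    fix D assume D: "D \<subseteq> Field \<kappa>" "cofinal D \<kappa>"
    have DL: "D \<subseteq> L" using D(1) unfolding L(1) Field_card_of .
    show "|D| =o \<kappa>"
    proof (rule ccontr)
      \<comment> \<open>A smaller cofinal set would cover \<open>L\<close> by fewer than
        \<open>\<kappa>\<close> proper initial segments, each of size below \<open>\<kappa>\<close>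
        and hence null.\<close>
      assume "\<not> |D| =o \<kappa>"
      then have "|D| <o |L|"
        using card_of_mono1[OF DL] unfolding L(1) ordLeq_iff_ordLess_or_ordIso by blast
      moreover have "?fib g (underS \<kappa> b) \<in> J" if "b \<in> D" for b
      proof (rule small_null)
        have "b \<in> Field \<kappa>" using that D by blast
        then show "|underS \<kappa> b| <o |L|"
          unfolding L(1) by (rule card_of_underS[OF card_of_Card_order])
        show "underS \<kappa> b \<subseteq> L"
          unfolding underS_def L(1) by (auto dest: FieldI1[of _ _ "|L|"] simp: Field_card_of)
      qed
      ultimately have "?fib g (\<Union>b\<in>D. underS \<kappa> b) \<in> J" by (rule complete)
      \<comment> \<open>\<open>cofinal\<close> is strict: every element of \<open>L\<close> lies
        properly below some member of \<open>D\<close>, so the open segments \<open>underS\<close>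
        already cover \<open>L\<close>.\<close>
      moreover have "L \<subseteq> (\<Union>b\<in>D. underS \<kappa> b)"
        using D(2) L unfolding cofinal_def underS_def by (auto simp: Field_card_of)
      ultimately have "?fib g L \<in> J" by (elim null_subset) auto
      then show False using whole by simp
    qed
  qed
  moreover have "ctwo ^c \<mu> <o \<kappa>" if \<mu>: "Card_order \<mu>" "\<mu> <o \<kappa>" for \<mu> :: "'a rel"
  proof (rule ccontr)
    let ?\<Lambda> = "Field \<mu>"
    assume "\<not> ctwo ^c \<mu> <o \<kappa>"
    then have "\<kappa> \<le>o ctwo ^c \<mu>"
      unfolding L(1)
      using ordLess_or_ordLeq[OF card_order_on_well_order_on[OF Card_order_cexp] card_of_Well_order]
      by blast
    then have "|L| \<le>o |Func ?\<Lambda> (UNIV :: bool set)|"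
      unfolding L(1) cexp_def ctwo_def Field_card_of .
    then obtain f where f: "inj_on f L" "f ` L \<subseteq> Func ?\<Lambda> (UNIV :: bool set)"
      unfolding card_of_ordLeq[symmetric] by blast
    \<comment> \<open>\<open>f l a\<close> is the bit of \<open>l\<close> at position
      \<open>a\<close>. \<open>B a\<close> consists of the elements whose bit at \<open>a\<close> is
      the exceptional one, so its preimage is null.\<close>
    define B where "B a = (if ?fib g {l \<in> L. f l a} \<in> J then {l \<in> L. f l a} else {l \<in> L. \<not> f l a})"
      for a
    have "?fib g (B a) \<in> J" for a
    proof -
      have "L - {l \<in> L. f l a} = {l \<in> L. \<not> f l a}" by blast
      then show ?thesis unfolding B_def using compl[of "{l \<in> L. f l a}"] by (auto split: if_splits)
    qed
    moreover have "|?\<Lambda>| <o |L|"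
      using ordIso_ordLess_trans[OF card_of_Field_ordIso[OF \<mu>(1)] \<mu>(2)] unfolding L(1) .
    ultimately have UJ: "?fib g (\<Union>a\<in>?\<Lambda>. B a) \<in> J" by (intro complete)
    \<comment> \<open>Outside all \<open>B a\<close> every bit has its majority value, so at most
      one element remains. Then all of \<open>L\<close> has a null preimage.\<close>
    have eq: "l = l'" if l: "l \<in> L - (\<Union>a\<in>?\<Lambda>. B a)" "l' \<in> L - (\<Union>a\<in>?\<Lambda>. B a)" for l l'
    proof -
      have "f l a = f l' a" if "a \<in> ?\<Lambda>" for a
      proof -
        have "l \<notin> B a" "l' \<notin> B a" using l that by blast+
        then show ?thesis using l unfolding B_def by (auto split: if_splits)
      qed
      moreover have "f l \<in> Func ?\<Lambda> UNIV" "f l' \<in> Func ?\<Lambda> UNIV" using f l by auto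
      ultimately have "f l = f l'" unfolding Func_def by fastforce
      then show ?thesis using f l by (auto dest: inj_onD)
    qed
    have "?fib g (L - (\<Union>a\<in>?\<Lambda>. B a)) \<in> J"
    proof (cases "L - (\<Union>a\<in>?\<Lambda>. B a) = {}")
      case True
      then show ?thesis using null_empty by (simp only: empty_iff simp_thms Collect_empty_eq[THEN iffD2])
    next
      case False
      then obtain l where "l \<in> L - (\<Union>a\<in>?\<Lambda>. B a)" by blast
      then have "L - (\<Union>a\<in>?\<Lambda>. B a) = {l}" "l \<in> L" using eq by blast+
      then show ?thesis using fib by simp
    qed
    then have "?fib g (L - (\<Union>a\<in>?\<Lambda>. B a)) \<union> ?fib g (\<Union>a\<in>?\<Lambda>. B a) \<in> J" using UJ by (rule null_Un)
    then have "?fib g L \<in> J" by (rule null_subset) blast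
    then show False using whole by simp
  qed
  ultimately have "strongly_inaccessible \<kappa>"
    unfolding strongly_inaccessible_def L(1) using card_of_Card_order by blast
  then show ?thesis using \<kappa>K by blast
qed

end

section \<open>Components of morphisms to a coproduct\<close>

text \<open>\<open>gfinprod\<close> takes the default value one on families of infinite support;
  finiteness makes the left side a genuine finite sum, to which additivity applies.\<close>

lemma hom_gfinprod:
  assumes "comm_group G" "comm_group H" "h \<in> hom G H"
    and f: "f \<in> I \<rightarrow> carrier G" and fin: "finite {i \<in> I. f i \<noteq> \<one>\<^bsub>G\<^esub>}"
  shows "h (gfinprod G f I) = gfinprod H (\<lambda>i. h (f i)) I"
proof -
  interpret G: comm_group G by fact
  interpret H: comm_group H by fact
  have h1: "h \<one>\<^bsub>G\<^esub> = \<one>\<^bsub>H\<^esub>"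
    using assms(3) G.group_axioms H.group_axioms by (simp add: hom_one)
  have hc: "h x \<in> carrier H" if "x \<in> carrier G" for x using assms(3) that by (rule hom_in_carrier)
  have *: "h (finprod G f F) = finprod H (\<lambda>i. h (f i)) F" if "finite F" "F \<subseteq> I" for F
    using that
  proof (induction rule: finite_induct)
    case (insert i F)
    moreover have "f \<in> F \<rightarrow> carrier G" "f i \<in> carrier G" using insert f by auto
    ultimately show ?case
      using assms(3) by (simp add: hom_mult Pi_def hc)
  qed (simp add: h1)
  have "gfinprod G f I = finprod G f {i \<in> I. f i \<noteq> \<one>\<^bsub>G\<^esub>}"
    using fin by (simp add: gfinprod_def)
  also have "h \<dots> = finprod H (\<lambda>i. h (f i)) {i \<in> I. f i \<noteq> \<one>\<^bsub>G\<^esub>}"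
    using fin by (intro *) auto
  also have "\<dots> = gfinprod H (\<lambda>i. h (f i)) {i \<in> I. f i \<noteq> \<one>\<^bsub>G\<^esub>}"
    using fin f hc by (intro H.gfinprod_eq_finprod[symmetric]) auto
  \<comment> \<open>\<open>h\<close> may kill some terms, so the support can shrink; the extra
    indices contribute only neutral terms.\<close>
  also have "\<dots> = gfinprod H (\<lambda>i. h (f i)) I"
    using f hc by (intro H.gfinprod_mono_neutral_cong_left) (auto simp: h1)
  finally show ?thesis .
qed

lemma (in comm_group) gfinprod_delta:
  assumes "j \<in> I" "x \<in> carrier G"
  shows "gfinprod G (\<lambda>i. if i = j then x else \<one>) I = x"
proof -
  have "gfinprod G (\<lambda>i. if i = j then x else \<one>) I = gfinprod G (\<lambda>i. x) {j}"
    using assms by (intro gfinprod_mono_neutral_cong_right) auto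
  also have "\<dots> = x" using assms by simp
  finally show ?thesis .
qed

section \<open>Zero morphisms and universal properties in preadditive categories\<close>

context preadditive_category
begin

lemma zero_mor_closed: "\<lbrakk>X \<in> Obj A; Y \<in> Obj A\<rbrakk> \<Longrightarrow> zero_mor A X Y \<in> Mor A X Y"
  using Hom_comm_group comm_group.axioms(1) comm_monoid.axioms(1) monoid.one_closed by blast

lemma cmp_left_hom:
  "\<lbrakk>X \<in> Obj A; Y \<in> Obj A; Z \<in> Obj A; g \<in> Mor A Y Z\<rbrakk>
    \<Longrightarrow> (\<lambda>f. g \<cdot> f) \<in> hom (Hom A X Y) (Hom A X Z)"
  unfolding hom_def by (auto intro: cmp_mor cmp_add_right)

lemma cmp_right_hom:
  "\<lbrakk>X \<in> Obj A; Y \<in> Obj A; Z \<in> Obj A; f \<in> Mor A X Y\<rbrakk>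
    \<Longrightarrow> (\<lambda>g. g \<cdot> f) \<in> hom (Hom A Y Z) (Hom A X Z)"
  unfolding hom_def by (auto intro: cmp_mor cmp_add_left)

lemma Hom_group: "\<lbrakk>X \<in> Obj A; Y \<in> Obj A\<rbrakk> \<Longrightarrow> group (Hom A X Y)"
  using Hom_comm_group comm_group.axioms(2) by blast

lemma cmp_zero_right:
  "\<lbrakk>X \<in> Obj A; Y \<in> Obj A; Z \<in> Obj A; g \<in> Mor A Y Z\<rbrakk> \<Longrightarrow> g \<cdot> zero_mor A X Y = zero_mor A X Z"
  using hom_one[OF cmp_left_hom] Hom_group by blast

lemma cmp_zero_left:
  "\<lbrakk>X \<in> Obj A; Y \<in> Obj A; Z \<in> Obj A; f \<in> Mor A X Y\<rbrakk> \<Longrightarrow> zero_mor A Y Z \<cdot> f = zero_mor A X Z"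
  using hom_one[OF cmp_right_hom] Hom_group by blast

lemma product_Obj: "is_product A K M P \<pi> \<Longrightarrow> P \<in> Obj A"
  and product_proj: "is_product A K M P \<pi> \<Longrightarrow> k \<in> K \<Longrightarrow> \<pi> k \<in> Mor A P (M k)"
  unfolding is_product_def by auto

lemma product_ex1:
  assumes "is_product A K M P \<pi>" "W \<in> Obj A" "\<forall>k \<in> K. f k \<in> Mor A W (M k)"
  shows "\<exists>!u. u \<in> Mor A W P \<and> (\<forall>k \<in> K. \<pi> k \<cdot> u = f k)"
proof -
  have "\<forall>f. (\<forall>k \<in> K. f k \<in> Mor A W (M k)) \<longrightarrow>
    (\<exists>!u. u \<in> Mor A W P \<and> (\<forall>k \<in> K. \<pi> k \<cdot> u = f k))"
    using assms(1,2) unfolding is_product_def by (elim conjE) (rule bspec)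
  from spec[OF this, of f] show ?thesis using assms(3) by (rule mp)
qed

lemma product_lift:
  assumes "is_product A K M P \<pi>" "W \<in> Obj A" "\<And>k. k \<in> K \<Longrightarrow> f k \<in> Mor A W (M k)"
  obtains u where "u \<in> Mor A W P" "\<And>k. k \<in> K \<Longrightarrow> \<pi> k \<cdot> u = f k"
  using ex1_implies_ex[OF product_ex1[OF assms(1,2), of f]] assms(3) by auto

lemma product_eqI:
  assumes P: "is_product A K M P \<pi>" and "W \<in> Obj A" "u \<in> Mor A W P" "v \<in> Mor A W P"
    and M: "\<And>k. k \<in> K \<Longrightarrow> M k \<in> Obj A"
    and eq: "\<And>k. k \<in> K \<Longrightarrow> \<pi> k \<cdot> u = \<pi> k \<cdot> v"
  shows "u = v"
proof -
  have "\<forall>k \<in> K. \<pi> k \<cdot> v \<in> Mor A W (M k)"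
    using assms product_Obj[OF P] product_proj[OF P] cmp_mor by blast
  then have "\<exists>!w. w \<in> Mor A W P \<and> (\<forall>k \<in> K. \<pi> k \<cdot> w = \<pi> k \<cdot> v)"
    by (rule product_ex1[OF P \<open>W \<in> Obj A\<close>])
  then show ?thesis using assms by blast
qed

lemma coproduct_Obj: "is_coproduct A I N S \<nu> \<Longrightarrow> S \<in> Obj A"
  and coproduct_inj: "is_coproduct A I N S \<nu> \<Longrightarrow> i \<in> I \<Longrightarrow> \<nu> i \<in> Mor A (N i) S"
  unfolding is_coproduct_def by auto

lemma coproduct_ex1:
  assumes "is_coproduct A I N S \<nu>" "W \<in> Obj A" "\<forall>i \<in> I. f i \<in> Mor A (N i) W"
  shows "\<exists>!u. u \<in> Mor A S W \<and> (\<forall>i \<in> I. u \<cdot> \<nu> i = f i)"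
proof -
  have "\<forall>f. (\<forall>i \<in> I. f i \<in> Mor A (N i) W) \<longrightarrow>
    (\<exists>!u. u \<in> Mor A S W \<and> (\<forall>i \<in> I. u \<cdot> \<nu> i = f i))"
    using assms(1,2) unfolding is_coproduct_def by (elim conjE) (rule bspec)
  from spec[OF this, of f] show ?thesis using assms(3) by (rule mp)
qed

lemma coproduct_eqI:
  assumes S: "is_coproduct A I N S \<nu>" and "W \<in> Obj A" "u \<in> Mor A S W" "v \<in> Mor A S W"
    and N: "\<And>i. i \<in> I \<Longrightarrow> N i \<in> Obj A"
    and eq: "\<And>i. i \<in> I \<Longrightarrow> u \<cdot> \<nu> i = v \<cdot> \<nu> i"
  shows "u = v"
proof -
  have "\<forall>i \<in> I. v \<cdot> \<nu> i \<in> Mor A (N i) W"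
    using assms coproduct_Obj[OF S] coproduct_inj[OF S] cmp_mor by blast
  then have "\<exists>!w. w \<in> Mor A S W \<and> (\<forall>i \<in> I. w \<cdot> \<nu> i = v \<cdot> \<nu> i)"
    by (rule coproduct_ex1[OF S \<open>W \<in> Obj A\<close>])
  then show ?thesis using assms by blast
qed

end

text \<open>The coordinate projection of a coproduct onto its summand \<open>N j\<close>, available
  because zero morphisms exist. For \<open>j\<close> in \<open>I\<close> the universal property
  makes the chosen morphism unique.\<close>

definition coproj ::
    "('o, 'm) hom_cat \<Rightarrow> 'i set \<Rightarrow> ('i \<Rightarrow> 'o) \<Rightarrow> 'o \<Rightarrow> ('i \<Rightarrow> 'm) \<Rightarrow> 'i \<Rightarrow> 'm" where
  "coproj A I N S \<nu> j = (SOME u. u \<in> Mor A S (N j) \<and>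
     (\<forall>i \<in> I. u \<cdot>\<^bsub>A\<^esub> \<nu> i = (if i = j then ident A (N j) else zero_mor A (N i) (N j))))"

definition supp ::
    "('o, 'm) hom_cat \<Rightarrow> 'i set \<Rightarrow> ('i \<Rightarrow> 'o) \<Rightarrow> 'o \<Rightarrow> ('i \<Rightarrow> 'm) \<Rightarrow> 'o \<Rightarrow> 'm \<Rightarrow> 'i set" where
  "supp A I N S \<nu> X f = {j \<in> I. coproj A I N S \<nu> j \<cdot>\<^bsub>A\<^esub> f \<noteq> zero_mor A X (N j)}"

section \<open>Supports of morphisms and bijectivity of the canonical map \<open>Psi\<close>\<close>

locale coproduct_in = preadditive_category A
  for A :: "('o, 'm) hom_cat" (structure)
    and I :: "'i set" and N :: "'i \<Rightarrow> 'o" and S :: 'o and \<nu> :: "'i \<Rightarrow> 'm" +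
  assumes coproduct: "is_coproduct A I N S \<nu>"
    and N_Obj: "i \<in> I \<Longrightarrow> N i \<in> Obj A"
begin

abbreviation "\<rho> \<equiv> coproj A I N S \<nu>"
abbreviation "supp_of \<equiv> supp A I N S \<nu>"

lemma S_Obj: "S \<in> Obj A" and inj_mor: "i \<in> I \<Longrightarrow> \<nu> i \<in> Mor A (N i) S"
  using coproduct_Obj[OF coproduct] coproduct_inj[OF coproduct] by auto

lemma
  assumes j: "j \<in> I"
  shows coproj_mor: "\<rho> j \<in> Mor A S (N j)"
    and coproj_inj: "\<And>i. i \<in> I \<Longrightarrow>
      \<rho> j \<cdot> \<nu> i = (if i = j then ident A (N j) else zero_mor A (N i) (N j))"
proof -
  let ?f = "\<lambda>i. if i = j then ident A (N j) else zero_mor A (N i) (N j)"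
  have "\<forall>i \<in> I. ?f i \<in> Mor A (N i) (N j)"
    using j N_Obj by (auto intro: ident_mor zero_mor_closed)
  then have "\<exists>!u. u \<in> Mor A S (N j) \<and> (\<forall>i \<in> I. u \<cdot> \<nu> i = ?f i)"
    by (rule coproduct_ex1[OF coproduct N_Obj[OF j]])
  then have "\<rho> j \<in> Mor A S (N j) \<and> (\<forall>i \<in> I. \<rho> j \<cdot> \<nu> i = ?f i)"
    unfolding coproj_def by (rule someI_ex[OF ex1_implies_ex])
  then show "\<rho> j \<in> Mor A S (N j)" "\<And>i. i \<in> I \<Longrightarrow> \<rho> j \<cdot> \<nu> i = ?f i" by auto
qed

lemma supp_cmp_subset:
  assumes "X \<in> Obj A" "Y \<in> Obj A" "f \<in> Mor A Y S" "g \<in> Mor A X Y"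
  shows "supp_of X (f \<cdot> g) \<subseteq> supp_of Y f"
proof -
  have "\<rho> j \<cdot> (f \<cdot> g) = zero_mor A X (N j)" if "j \<in> I" "\<rho> j \<cdot> f = zero_mor A Y (N j)" for j
    using assms that S_Obj N_Obj coproj_mor cmp_assoc[of X Y S "N j" g f "\<rho> j"]
    by (simp add: cmp_zero_left)
  then show ?thesis unfolding supp_def by blast
qed

lemma supp_add_subset:
  assumes "X \<in> Obj A" "f \<in> Mor A X S" "g \<in> Mor A X S"
  shows "supp_of X (f \<otimes>\<^bsub>Hom A X S\<^esub> g) \<subseteq> supp_of X f \<union> supp_of X g"
proof -
  have "\<rho> j \<cdot> (f \<otimes>\<^bsub>Hom A X S\<^esub> g) = zero_mor A X (N j)"
    if "j \<in> I" "\<rho> j \<cdot> f = zero_mor A X (N j)" "\<rho> j \<cdot> g = zero_mor A X (N j)" for j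
  proof -
    interpret group "Hom A X (N j)" using that assms N_Obj by (intro Hom_group)
    have "\<rho> j \<cdot> (f \<otimes>\<^bsub>Hom A X S\<^esub> g) = \<rho> j \<cdot> f \<otimes>\<^bsub>Hom A X (N j)\<^esub> \<rho> j \<cdot> g"
      using assms that S_Obj N_Obj coproj_mor by (intro cmp_add_right)
    then show ?thesis using that by simp
  qed
  then show ?thesis unfolding supp_def by blast
qed

lemma Psi_hom:
  assumes "X \<in> Obj A"
  shows "Psi A X I S \<nu> \<in> hom (sum_group I (\<lambda>i. Hom A X (N i))) (Hom A X S)"
proof -
  interpret comm_group "Hom A X S" using assms S_Obj by (rule Hom_comm_group)
  show ?thesis
    unfolding Psi_def[abs_def]
    by (rule hom_group_sum) (auto intro: cmp_left_hom Hom_group simp: assms N_Obj S_Obj inj_mor)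
qed

lemma sum_group_carrier:
  assumes "X \<in> Obj A"
  shows "carrier (sum_group I (\<lambda>i. Hom A X (N i))) =
    {\<phi> \<in> \<Pi>\<^sub>E i\<in>I. Mor A X (N i). finite {i \<in> I. \<phi> i \<noteq> zero_mor A X (N i)}}"
  by (rule carrier_sum_group) (simp add: assms N_Obj Hom_group)

text \<open>The projection acts termwise on the finite sum and kills every term except the one at
  \<open>j\<close>. So the coordinates of a morphism recover its preimage under
  \<open>Psi\<close>.\<close>

lemma coproj_Psi:
  assumes X: "X \<in> Obj A" and \<phi>: "\<phi> \<in> carrier (sum_group I (\<lambda>i. Hom A X (N i)))" and j: "j \<in> I"
  shows "\<rho> j \<cdot> Psi A X I S \<nu> \<phi> = \<phi> j"
proof -
  have \<phi>_mor: "\<phi> i \<in> Mor A X (N i)" if "i \<in> I" for i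
    using \<phi> that sum_group_carrier[OF X] by (auto simp: PiE_def Pi_def)
  have fin: "finite {i \<in> I. \<phi> i \<noteq> zero_mor A X (N i)}"
    using \<phi> sum_group_carrier[OF X] by simp
  interpret Nj: comm_group "Hom A X (N j)" using X N_Obj[OF j] by (rule Hom_comm_group)
  have "\<rho> j \<cdot> Psi A X I S \<nu> \<phi> = gfinprod (Hom A X (N j)) (\<lambda>i. \<rho> j \<cdot> (\<nu> i \<cdot> \<phi> i)) I"
    unfolding Psi_def
  proof (rule hom_gfinprod)
    show "(\<lambda>i. \<nu> i \<cdot> \<phi> i) \<in> I \<rightarrow> Mor A X S"
      using X S_Obj N_Obj inj_mor \<phi>_mor by (blast intro: cmp_mor)
    show "finite {i \<in> I. \<nu> i \<cdot> \<phi> i \<noteq> zero_mor A X S}"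
      by (rule finite_subset[OF _ fin]) (use X S_Obj N_Obj inj_mor cmp_zero_right in auto)
    show "(\<lambda>f. \<rho> j \<cdot> f) \<in> hom (Hom A X S) (Hom A X (N j))"
      by (intro cmp_left_hom X S_Obj N_Obj j coproj_mor)
  qed (simp_all add: Hom_comm_group X S_Obj N_Obj j)
  also have "\<dots> = gfinprod (Hom A X (N j)) (\<lambda>i. if i = j then \<phi> j else zero_mor A X (N j)) I"
  proof -
    have "\<rho> j \<cdot> (\<nu> i \<cdot> \<phi> i) = (if i = j then \<phi> j else zero_mor A X (N j))" if "i \<in> I" for i
    proof -
      have "\<rho> j \<cdot> (\<nu> i \<cdot> \<phi> i) = (\<rho> j \<cdot> \<nu> i) \<cdot> \<phi> i"
        using that X S_Obj N_Obj inj_mor \<phi>_mor coproj_mor j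
        by (intro cmp_assoc[of X "N i" S "N j", symmetric]) simp_all
      also have "\<dots> = (if i = j then \<phi> j else zero_mor A X (N j))"
        using that X N_Obj \<phi>_mor j by (simp add: coproj_inj cmp_ident_left cmp_zero_left)
      finally show ?thesis .
    qed
    then show ?thesis
      using \<phi>_mor[OF j] by (intro Nj.gfinprod_cong) (auto simp: simp_implies_def)
  qed
  also have "\<dots> = \<phi> j" using j \<phi>_mor[OF j] by (rule Nj.gfinprod_delta)
  finally show ?thesis .
qed

lemma Psi_inj_on:
  assumes "X \<in> Obj A"
  shows "inj_on (Psi A X I S \<nu>) (carrier (sum_group I (\<lambda>i. Hom A X (N i))))"
proof (rule inj_onI)
  fix \<phi> \<psi> assume \<phi>: "\<phi> \<in> carrier (sum_group I (\<lambda>i. Hom A X (N i)))"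
    and \<psi>: "\<psi> \<in> carrier (sum_group I (\<lambda>i. Hom A X (N i)))"
    and eq: "Psi A X I S \<nu> \<phi> = Psi A X I S \<nu> \<psi>"
  have "\<phi> j = \<psi> j" if "j \<in> I" for j
    using coproj_Psi[OF assms \<phi> that] coproj_Psi[OF assms \<psi> that] eq by simp
  then show "\<phi> = \<psi>"
    using \<phi> \<psi> sum_group_carrier[OF assms] by (auto intro: PiE_ext)
qed

text \<open>A preimage of \<open>f\<close> under \<open>Psi\<close> lies in the direct sum, and its
  nonzero entries are exactly at the support of \<open>f\<close>.\<close>

lemma finite_supp_if_iso:
  assumes X: "X \<in> Obj A"
    and iso: "Psi A X I S \<nu> \<in> iso (sum_group I (\<lambda>i. Hom A X (N i))) (Hom A X S)"
    and f: "f \<in> Mor A X S"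
  shows "finite (supp_of X f)"
proof -
  obtain \<phi> where \<phi>: "\<phi> \<in> carrier (sum_group I (\<lambda>i. Hom A X (N i)))" "f = Psi A X I S \<nu> \<phi>"
    using iso f unfolding iso_def bij_betw_def by blast
  then have "supp_of X f = {i \<in> I. \<phi> i \<noteq> zero_mor A X (N i)}"
    unfolding supp_def using coproj_Psi[OF X] by auto
  then show ?thesis using \<phi>(1) sum_group_carrier[OF X] by simp
qed

text \<open>The preimage of \<open>f\<close> has to be the family of its coordinates, which lies in
  the direct sum by \<open>fin\<close>. The difference \<open>?d\<close> between \<open>f\<close>
  and the image of this family has zero coordinates; \<open>zero\<close> is what turns this into
  equality.\<close>

lemma iso_if_finite_supp:
  assumes X: "X \<in> Obj A"
    and fin: "\<And>f. f \<in> Mor A X S \<Longrightarrow> finite (supp_of X f)"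
    and zero: "\<And>f. f \<in> Mor A X S \<Longrightarrow> supp_of X f = {} \<Longrightarrow> f = zero_mor A X S"
  shows "Psi A X I S \<nu> \<in> iso (sum_group I (\<lambda>i. Hom A X (N i))) (Hom A X S)"
proof -
  let ?D = "carrier (sum_group I (\<lambda>i. Hom A X (N i)))"
  have "f \<in> Psi A X I S \<nu> ` ?D" if f: "f \<in> Mor A X S" for f
  proof
    let ?\<phi> = "\<lambda>i\<in>I. \<rho> i \<cdot> f"
    interpret G: comm_group "Hom A X S" using X S_Obj by (rule Hom_comm_group)
    have "{i \<in> I. ?\<phi> i \<noteq> zero_mor A X (N i)} = supp_of X f" unfolding supp_def by auto
    then show \<phi>: "?\<phi> \<in> ?D"
      unfolding sum_group_carrier[OF X]
      using fin[OF f] f X S_Obj N_Obj coproj_mor by (auto intro: cmp_mor)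
    have Psi: "Psi A X I S \<nu> ?\<phi> \<in> Mor A X S"
      using Psi_hom[OF X] \<phi> by (rule hom_in_carrier)
    let ?d = "f \<otimes>\<^bsub>Hom A X S\<^esub> inv\<^bsub>Hom A X S\<^esub> (Psi A X I S \<nu> ?\<phi>)"
    have "\<rho> j \<cdot> ?d = zero_mor A X (N j)" if j: "j \<in> I" for j
    proof -
      interpret Nj: comm_group "Hom A X (N j)" using X N_Obj[OF j] by (rule Hom_comm_group)
      interpret h: group_hom "Hom A X S" "Hom A X (N j)" "\<lambda>f. \<rho> j \<cdot> f"
        by unfold_locales (intro cmp_left_hom X S_Obj N_Obj j coproj_mor)
      show ?thesis
        using f Psi coproj_Psi[OF X \<phi> j] j h.hom_closed[OF f] by (simp add: Nj.r_inv)
    qed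
    then have "supp_of X ?d = {}" unfolding supp_def by blast
    then have "?d = zero_mor A X S" using f Psi by (intro zero) auto
    then show "f = Psi A X I S \<nu> ?\<phi>" using f Psi by (metis G.inv_inv G.inv_equality G.inv_closed)
  qed
  then have "Psi A X I S \<nu> ` ?D = Mor A X S"
    using hom_in_carrier[OF Psi_hom[OF X]] by blast
  then show ?thesis
    unfolding iso_def bij_betw_def using Psi_hom[OF X] Psi_inj_on[OF X] by blast
qed

text \<open>The entries of a preimage under \<open>Psi\<close> are the coordinates of
  \<open>f\<close>, hence zero. This lets compact objects test whether a morphism to
  \<open>S\<close> with empty support vanishes.\<close>

lemma zero_if_supp_empty:
  assumes X: "X \<in> Obj A"
    and iso: "Psi A X I S \<nu> \<in> iso (sum_group I (\<lambda>i. Hom A X (N i))) (Hom A X S)"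
    and f: "f \<in> Mor A X S" "supp_of X f = {}"
  shows "f = zero_mor A X S"
proof -
  let ?D = "sum_group I (\<lambda>i. Hom A X (N i))"
  obtain \<phi> where \<phi>: "\<phi> \<in> carrier ?D" "f = Psi A X I S \<nu> \<phi>"
    using iso f unfolding iso_def bij_betw_def by blast
  have "\<phi> j = zero_mor A X (N j)" if "j \<in> I" for j
    using coproj_Psi[OF X \<phi>(1) that] \<phi>(2) f(2) that unfolding supp_def by auto
  then have "\<phi> = \<one>\<^bsub>?D\<^esub>"
    using \<phi>(1) unfolding sum_group_carrier[OF X] by (auto simp: PiE_iff extensional_def)
  then show ?thesis
    using \<phi>(2) hom_one[OF Psi_hom[OF X]] by (simp add: Hom_group X N_Obj S_Obj)
qed

end

lemma (in preadditive_category) product_incl: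
  assumes P: "is_product A K M P \<pi>" and M: "\<And>k. k \<in> K \<Longrightarrow> M k \<in> Obj A" and k: "k \<in> K"
  obtains u where "u \<in> Mor A (M k) P"
    "\<And>l. l \<in> K \<Longrightarrow> \<pi> l \<cdot> u = (if l = k then ident A (M k) else zero_mor A (M k) (M l))"
proof (rule product_lift[OF P M[OF k], of "\<lambda>l. if l = k then ident A (M k) else zero_mor A (M k) (M l)"])
  show "(if l = k then ident A (M k) else zero_mor A (M k) (M l)) \<in> Mor A (M k) (M l)" if "l \<in> K" for l
    using that k M by (simp add: ident_mor zero_mor_closed)
qed (rule that)

section \<open>Morphisms from a product to a coproduct\<close>

text \<open>Greedy choice: \<open>F n\<close> holds the finitely many values used before stage
  \<open>n\<close>, and an infinite \<open>B n\<close> always offers a new one.\<close>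

lemma distinct_representatives:
  fixes B :: "nat \<Rightarrow> 'a set"
  assumes inf: "\<And>n. infinite (B n)"
  obtains a where "inj a" "\<And>n. a n \<in> B n"
proof -
  have "\<exists>F. \<forall>n. finite (F n) \<and> (\<exists>x \<in> B n - F n. F (Suc n) = insert x (F n))"
  proof (rule dependent_nat_choice)
    show "\<exists>F :: 'a set. finite F" by blast
    fix F :: "'a set" and n assume F: "finite F"
    then have "B n - F \<noteq> {}" using inf[of n] by (metis Diff_eq_empty_iff finite_subset)
    then show "\<exists>F'. finite F' \<and> (\<exists>x \<in> B n - F. F' = insert x F)" using F by blast
  qed
  then obtain F a where Fa: "\<And>n. a n \<in> B n - F n" "\<And>n. F (Suc n) = insert (a n) (F n)"
    by metis
  have mono: "F m \<subseteq> F n" if "m \<le> n" for m n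
    using that by (rule lift_Suc_mono_le[rotated]) (simp add: Fa(2) subset_insertI)
  have "a m \<noteq> a n" if "m < n" for m n
    using Fa mono[of "Suc m" n] that by auto
  then have "inj a" by (metis injI linorder_neqE_nat)
  then show ?thesis using that Fa(1) by blast
qed

text \<open>An endomorphism of \<open>P\<close> stands in for the subproduct over \<open>T\<close>,
  so that morphisms for different \<open>T\<close> share the source \<open>P\<close> and can be
  added and composed.\<close>

definition truncation ::
    "('o, 'm) hom_cat \<Rightarrow> 'k set \<Rightarrow> ('k \<Rightarrow> 'o) \<Rightarrow> 'o \<Rightarrow> ('k \<Rightarrow> 'm) \<Rightarrow> 'k set \<Rightarrow> 'm" where
  "truncation A K M P \<pi> T = (SOME u. u \<in> Mor A P P \<and>
     (\<forall>k \<in> K. \<pi> k \<cdot>\<^bsub>A\<^esub> u = (if k \<in> T then \<pi> k else zero_mor A P (M k))))"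

section \<open>Truncations of a product and the ideal of null index sets\<close>

locale product_to_coproduct = coproduct_in A I N S \<nu>
  for A :: "('o, 'm) hom_cat" (structure)
    and I :: "'i set" and N :: "'i \<Rightarrow> 'o" and S :: 'o and \<nu> :: "'i \<Rightarrow> 'm" +
  fixes K :: "'k set" and M :: "'k \<Rightarrow> 'o" and P :: 'o and \<pi> :: "'k \<Rightarrow> 'm" and f :: 'm
  assumes product: "is_product A K M P \<pi>"
    and M_Obj: "k \<in> K \<Longrightarrow> M k \<in> Obj A"
    and f_mor: "f \<in> Mor A P S"
begin

abbreviation "trunc \<equiv> truncation A K M P \<pi>"

lemma P_Obj: "P \<in> Obj A" and proj_mor: "k \<in> K \<Longrightarrow> \<pi> k \<in> Mor A P (M k)"
  using product_Obj[OF product] product_proj[OF product] by auto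

lemma
  shows trunc_mor: "trunc T \<in> Mor A P P"
    and proj_trunc: "k \<in> K \<Longrightarrow> \<pi> k \<cdot> trunc T = (if k \<in> T then \<pi> k else zero_mor A P (M k))"
proof -
  have "\<forall>k \<in> K. (if k \<in> T then \<pi> k else zero_mor A P (M k)) \<in> Mor A P (M k)"
    using P_Obj M_Obj proj_mor by (simp add: zero_mor_closed)
  from someI_ex[OF ex1_implies_ex[OF product_ex1[OF product P_Obj this]]]
  have "trunc T \<in> Mor A P P \<and>
    (\<forall>k \<in> K. \<pi> k \<cdot> trunc T = (if k \<in> T then \<pi> k else zero_mor A P (M k)))"
    unfolding truncation_def .
  then show "trunc T \<in> Mor A P P"
    "k \<in> K \<Longrightarrow> \<pi> k \<cdot> trunc T = (if k \<in> T then \<pi> k else zero_mor A P (M k))" by auto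
qed

lemma proj_trunc_cmp:
  assumes X: "X \<in> Obj A" and g: "g \<in> Mor A X P" and k: "k \<in> K"
  shows "\<pi> k \<cdot> (trunc T \<cdot> g) = (if k \<in> T then \<pi> k \<cdot> g else zero_mor A X (M k))"
proof -
  have "\<pi> k \<cdot> (trunc T \<cdot> g) = (\<pi> k \<cdot> trunc T) \<cdot> g"
    by (rule cmp_assoc[OF X P_Obj P_Obj M_Obj[OF k] g trunc_mor proj_mor[OF k], symmetric])
  then show ?thesis
    using cmp_zero_left[OF X P_Obj M_Obj[OF k] g] by (simp add: proj_trunc k)
qed

lemma trunc_cmp_trunc:
  assumes "T' \<subseteq> T"
  shows "trunc T \<cdot> trunc T' = trunc T'"
proof (rule product_eqI[OF product P_Obj _ _ M_Obj])
  show "trunc T \<cdot> trunc T' \<in> Mor A P P" by (rule cmp_mor[OF P_Obj P_Obj P_Obj trunc_mor trunc_mor])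
  show "\<pi> k \<cdot> (trunc T \<cdot> trunc T') = \<pi> k \<cdot> trunc T'" if "k \<in> K" for k
    using that assms by (auto simp: proj_trunc_cmp[OF P_Obj trunc_mor] proj_trunc)
qed (rule trunc_mor)

text \<open>The second summand uses \<open>T' - T\<close> so that coordinates in the intersection
  are not counted twice.\<close>

lemma trunc_Un: "trunc (T \<union> T') = trunc T \<otimes>\<^bsub>Hom A P P\<^esub> trunc (T' - T)"
proof (rule product_eqI[OF product P_Obj _ _ M_Obj])
  interpret PP: group "Hom A P P" using P_Obj P_Obj by (rule Hom_group)
  show "trunc T \<otimes>\<^bsub>Hom A P P\<^esub> trunc (T' - T) \<in> Mor A P P" by (simp add: trunc_mor)
  fix k assume k: "k \<in> K"
  interpret Pk: group "Hom A P (M k)" using P_Obj M_Obj[OF k] by (rule Hom_group)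
  show "\<pi> k \<cdot> trunc (T \<union> T') = \<pi> k \<cdot> (trunc T \<otimes>\<^bsub>Hom A P P\<^esub> trunc (T' - T))"
    using k proj_mor[OF k] P_Obj M_Obj trunc_mor
      cmp_add_right[of P P "M k" "trunc T" "trunc (T' - T)" "\<pi> k"]
    by (simp add: proj_trunc)
qed (rule trunc_mor)

lemma trunc_all: "trunc K = ident A P"
  by (rule product_eqI[OF product P_Obj _ _ M_Obj])
    (simp_all add: proj_trunc trunc_mor P_Obj ident_mor cmp_ident_right[OF P_Obj M_Obj proj_mor])

definition null :: "'k set set" where
  "null = {T. finite (supp_of P (f \<cdot> trunc T))}"

lemma f_trunc_mor: "f \<cdot> trunc T \<in> Mor A P S"
  using cmp_mor[OF P_Obj P_Obj S_Obj trunc_mor f_mor] .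

text \<open>Truncation to \<open>T'\<close> factors through truncation to \<open>T\<close>, and
  precomposition cannot enlarge the support.\<close>

lemma null_subset: "T \<in> null \<Longrightarrow> T' \<subseteq> T \<Longrightarrow> T' \<in> null"
proof -
  assume T: "T \<in> null" "T' \<subseteq> T"
  then have "f \<cdot> trunc T' = (f \<cdot> trunc T) \<cdot> trunc T'"
    using cmp_assoc[OF P_Obj P_Obj P_Obj S_Obj trunc_mor trunc_mor f_mor] by (simp add: trunc_cmp_trunc)
  then have "supp_of P (f \<cdot> trunc T') \<subseteq> supp_of P (f \<cdot> trunc T)"
    using supp_cmp_subset[OF P_Obj P_Obj f_trunc_mor trunc_mor] by simp
  then show "T' \<in> null" using T finite_subset unfolding null_def by blast
qed

lemma null_Un: "T \<in> null \<Longrightarrow> T' \<in> null \<Longrightarrow> T \<union> T' \<in> null"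
proof -
  assume T: "T \<in> null" "T' \<in> null"
  then have T'': "T' - T \<in> null" using null_subset by blast
  have "f \<cdot> trunc (T \<union> T') = f \<cdot> trunc T \<otimes>\<^bsub>Hom A P S\<^esub> f \<cdot> trunc (T' - T)"
    unfolding trunc_Un by (rule cmp_add_right[OF P_Obj P_Obj S_Obj trunc_mor trunc_mor f_mor])
  then have "supp_of P (f \<cdot> trunc (T \<union> T')) \<subseteq> supp_of P (f \<cdot> trunc T) \<union> supp_of P (f \<cdot> trunc (T' - T))"
    using supp_add_subset[OF P_Obj f_trunc_mor f_trunc_mor] by simp
  then show "T \<union> T' \<in> null" using T T'' finite_subset unfolding null_def by blast
qed

text \<open>Truncation to one index factors through the factor \<open>M k\<close>, so the support is
  bounded by that of a morphism out of \<open>M k\<close>.\<close>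

lemma null_singleton:
  assumes k: "k \<in> K" and fin: "\<And>g. g \<in> Mor A (M k) S \<Longrightarrow> finite (supp_of (M k) g)"
  shows "{k} \<in> null"
proof -
  obtain u where u: "u \<in> Mor A (M k) P"
    "\<And>l. l \<in> K \<Longrightarrow> \<pi> l \<cdot> u = (if l = k then ident A (M k) else zero_mor A (M k) (M l))"
    using product_incl[OF product M_Obj k] by blast
  have "trunc {k} = u \<cdot> \<pi> k"
  proof (rule product_eqI[OF product P_Obj _ _ M_Obj])
    fix l assume l: "l \<in> K"
    show "\<pi> l \<cdot> trunc {k} = \<pi> l \<cdot> (u \<cdot> \<pi> k)"
      using cmp_assoc[OF P_Obj M_Obj[OF k] P_Obj M_Obj[OF l] proj_mor[OF k] u(1) proj_mor[OF l]]
        cmp_ident_left[OF P_Obj M_Obj[OF k] proj_mor[OF k]]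
        cmp_zero_left[OF P_Obj M_Obj[OF k] M_Obj[OF l] proj_mor[OF k]]
      by (auto simp: proj_trunc u(2) l split: if_splits)
  qed (use trunc_mor cmp_mor[OF P_Obj M_Obj[OF k] P_Obj proj_mor[OF k] u(1)] in auto)
  moreover have "f \<cdot> (u \<cdot> \<pi> k) = (f \<cdot> u) \<cdot> \<pi> k"
    using cmp_assoc[OF P_Obj M_Obj[OF k] P_Obj S_Obj proj_mor[OF k] u(1) f_mor] by simp
  moreover have fu: "f \<cdot> u \<in> Mor A (M k) S"
    using cmp_mor[OF M_Obj[OF k] P_Obj S_Obj u(1) f_mor] .
  ultimately have "supp_of P (f \<cdot> trunc {k}) \<subseteq> supp_of (M k) (f \<cdot> u)"
    using supp_cmp_subset[OF P_Obj M_Obj[OF k] fu proj_mor[OF k]] by simp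
  then show ?thesis using fin[OF fu] finite_subset unfolding null_def by blast
qed

text \<open>
  Gliding hump. Since \<open>T\<close> is point-finite, the morphisms \<open>trunc (T w) \<cdot> g w\<close> out of the objects \<open>G w\<close>
  extend to one morphism out of their product, whose components are finite sums.
\<close>

lemma gliding_hump:
  assumes W: "W \<subseteq> I" and Q: "is_product A W G Q q"
    and G: "\<And>w. w \<in> W \<Longrightarrow> G w \<in> Obj A" and g: "\<And>w. w \<in> W \<Longrightarrow> g w \<in> Mor A (G w) P"
    and T: "\<And>k. k \<in> K \<Longrightarrow> finite {w \<in> W. k \<in> T w}"
    and hump: "\<And>w. w \<in> W \<Longrightarrow> w \<in> supp_of (G w) (f \<cdot> (trunc (T w) \<cdot> g w))"
  obtains h where "h \<in> Mor A Q P" "W \<subseteq> supp_of Q (f \<cdot> h)"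
proof -
  have Q_Obj: "Q \<in> Obj A" and q: "\<And>w. w \<in> W \<Longrightarrow> q w \<in> Mor A Q (G w)"
    using product_Obj[OF Q] product_proj[OF Q] by auto
  \<comment> \<open>For \<open>k\<close> in \<open>K\<close>, \<open>t k w\<close> is the coordinate
    at \<open>k\<close> of \<open>trunc (T w) \<cdot> (g w \<cdot> q w)\<close>. It is nonzero for
    only finitely many \<open>w\<close>, so these morphisms can be summed coordinatewise even when
    \<open>W\<close> is infinite.\<close>
  define t where "t k w = (if k \<in> T w then \<pi> k \<cdot> (g w \<cdot> q w) else zero_mor A Q (M k))" for k w
  have t: "t k w \<in> Mor A Q (M k)" if "k \<in> K" "w \<in> W" for k w
  proof -
    have "g w \<cdot> q w \<in> Mor A Q P" using Q_Obj G P_Obj q g that by (intro cmp_mor[of Q "G w" P])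
    then show ?thesis
      unfolding t_def using Q_Obj P_Obj M_Obj proj_mor that
      by (simp add: zero_mor_closed cmp_mor[of Q P "M k"])
  qed
  have "gfinprod (Hom A Q (M k)) (t k) W \<in> Mor A Q (M k)" if "k \<in> K" for k
  proof -
    interpret comm_group "Hom A Q (M k)" using Q_Obj M_Obj[OF that] by (rule Hom_comm_group)
    show ?thesis using t[OF that] by (intro gfinprod_closed) auto
  qed
  then obtain h where h: "h \<in> Mor A Q P"
    and proj_h: "\<And>k. k \<in> K \<Longrightarrow> \<pi> k \<cdot> h = gfinprod (Hom A Q (M k)) (t k) W"
    using product_lift[OF product Q_Obj, of "\<lambda>k. gfinprod (Hom A Q (M k)) (t k) W"] by blast
  have "w \<in> supp_of Q (f \<cdot> h)" if w: "w \<in> W" for w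
  proof -
    obtain u where u: "u \<in> Mor A (G w) Q"
      "\<And>v. v \<in> W \<Longrightarrow> q v \<cdot> u = (if v = w then ident A (G w) else zero_mor A (G w) (G v))"
      using product_incl[OF Q G w] by blast
    \<comment> \<open>On the factor \<open>G w\<close> of \<open>Q\<close> only the summand of
      \<open>h\<close> with index \<open>w\<close> survives. So the coordinate of
      \<open>f \<cdot> h\<close> at \<open>w\<close> is already nonzero on
      \<open>G w\<close>.\<close>
    have "h \<cdot> u = trunc (T w) \<cdot> g w"
    proof (rule product_eqI[OF product G[OF w] _ _ M_Obj])
      show "h \<cdot> u \<in> Mor A (G w) P" using cmp_mor[OF G[OF w] Q_Obj P_Obj u(1) h] .
      show "trunc (T w) \<cdot> g w \<in> Mor A (G w) P"
        using cmp_mor[OF G[OF w] P_Obj P_Obj g[OF w] trunc_mor] .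
      fix k assume k: "k \<in> K"
      interpret comm_group "Hom A (G w) (M k)" using G[OF w] M_Obj[OF k] by (rule Hom_comm_group)
      let ?z = "zero_mor A (G w) (M k)"
      let ?x = "if k \<in> T w then \<pi> k \<cdot> g w else ?z"
      have x: "?x \<in> Mor A (G w) (M k)"
        using cmp_mor[OF G[OF w] P_Obj M_Obj[OF k] g[OF w] proj_mor[OF k]] by simp
      have tu: "t k v \<cdot> u = (if v = w then ?x else ?z)" if v: "v \<in> W" for v
      proof (cases "k \<in> T v")
        case True
        have gq: "g v \<cdot> q v \<in> Mor A Q P" using cmp_mor[OF Q_Obj G[OF v] P_Obj q[OF v] g[OF v]] .
        have "(\<pi> k \<cdot> (g v \<cdot> q v)) \<cdot> u = \<pi> k \<cdot> (g v \<cdot> (q v \<cdot> u))"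
          unfolding cmp_assoc[OF G[OF w] Q_Obj P_Obj M_Obj[OF k] u(1) gq proj_mor[OF k]]
            cmp_assoc[OF G[OF w] Q_Obj G[OF v] P_Obj u(1) q[OF v] g[OF v]] ..
        also have "\<dots> = (if v = w then \<pi> k \<cdot> g w else ?z)"
          using G g w v P_Obj M_Obj k proj_mor
          by (simp add: u(2) cmp_ident_right[of "G w" P] cmp_zero_right[of "G w" "G v" P]
              cmp_zero_right[of "G w" P])
        finally show ?thesis using True by (auto simp: t_def)
      qed (use k in \<open>auto simp: t_def cmp_zero_left[OF G[OF w] Q_Obj M_Obj u(1)]\<close>)
      have "\<pi> k \<cdot> (h \<cdot> u) = gfinprod (Hom A Q (M k)) (t k) W \<cdot> u"
        using cmp_assoc[OF G[OF w] Q_Obj P_Obj M_Obj[OF k] u(1) h proj_mor[OF k]] proj_h[OF k]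
        by simp
      also have "\<dots> = gfinprod (Hom A (G w) (M k)) (\<lambda>v. t k v \<cdot> u) W"
      proof (rule hom_gfinprod)
        show "(\<lambda>g. g \<cdot> u) \<in> hom (Hom A Q (M k)) (Hom A (G w) (M k))"
          by (intro cmp_right_hom G w Q_Obj M_Obj k u(1))
        show "finite {v \<in> W. t k v \<noteq> zero_mor A Q (M k)}"
          by (rule finite_subset[OF _ T[OF k]]) (auto simp: t_def)
      qed (use t k in \<open>auto intro: Hom_comm_group simp: Q_Obj M_Obj G w\<close>)
      also have "\<dots> = gfinprod (Hom A (G w) (M k)) (\<lambda>v. if v = w then ?x else ?z) W"
        using x tu by (intro gfinprod_cong) (auto simp: simp_implies_def)
      also have "\<dots> = ?x" using w x by (rule gfinprod_delta)
      also have "\<dots> = \<pi> k \<cdot> (trunc (T w) \<cdot> g w)" using proj_trunc_cmp[OF G[OF w] g[OF w] k] by simp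
      finally show "\<pi> k \<cdot> (h \<cdot> u) = \<pi> k \<cdot> (trunc (T w) \<cdot> g w)" .
    qed
    then have "w \<in> supp_of (G w) ((f \<cdot> h) \<cdot> u)"
      using hump[OF w] cmp_assoc[OF G[OF w] Q_Obj P_Obj S_Obj u(1) h f_mor] by simp
    then show ?thesis
      using supp_cmp_subset[OF G[OF w] Q_Obj cmp_mor[OF Q_Obj P_Obj S_Obj h f_mor] u(1)] by blast
  qed
  then show ?thesis using h that by blast
qed

text \<open>If no \<open>T n\<close> were null, each composite with a truncation would have infinite
  support, so distinct indices \<open>a n\<close> could be picked from these supports. A generator
  detects each chosen nonzero coordinate, and \<open>gliding_hump\<close> joins the detecting
  morphisms into one whose composite with \<open>f\<close> has infinite support, contradicting
  \<open>prods\<close>.\<close>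

lemma null_point_finite:
  assumes T: "\<And>k. finite {n :: nat. k \<in> T n}"
    and tests: "\<And>i g. \<lbrakk>i \<in> I; g \<in> Mor A P (N i); g \<noteq> zero_mor A P (N i)\<rbrakk>
      \<Longrightarrow> \<exists>G \<in> \<G>. \<exists>e \<in> Mor A G P. g \<cdot> e \<noteq> zero_mor A G (N i)"
    and \<G>: "\<G> \<subseteq> Obj A"
    and prods: "\<And>W G. \<lbrakk>W \<subseteq> I; G \<in> W \<rightarrow> \<G>\<rbrakk>
      \<Longrightarrow> \<exists>Q q. is_product A W G Q q \<and> (\<forall>h \<in> Mor A Q S. finite (supp_of Q h))"
  shows "\<exists>n. T n \<in> null"
proof (rule ccontr)
  assume "\<not> (\<exists>n. T n \<in> null)"
  then have "infinite (supp_of P (f \<cdot> trunc (T n)))" for n unfolding null_def by blast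
  then obtain a where a: "inj a" "\<And>n :: nat. a n \<in> supp_of P (f \<cdot> trunc (T n))"
    using distinct_representatives[of "\<lambda>n. supp_of P (f \<cdot> trunc (T n))"] by blast
  let ?W = "range a"
  \<comment> \<open>The sets are reindexed by the chosen coordinates, so the product of generators
    is indexed by a subset of \<open>I\<close>, as \<open>prods\<close> requires.\<close>
  define T' where "T' w = T (inv_into UNIV a w)" for w
  have T'_a: "T' (a n) = T n" for n using a(1) by (simp add: T'_def)
  have W: "?W \<subseteq> I" using a(2) unfolding supp_def by blast
  have "\<exists>G e. G \<in> \<G> \<and> e \<in> Mor A G P \<and> w \<in> supp_of G (f \<cdot> (trunc (T' w) \<cdot> e))"
    if "w \<in> ?W" for w
  proof -
    have w: "w \<in> I" "\<rho> w \<cdot> (f \<cdot> trunc (T' w)) \<noteq> zero_mor A P (N w)"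
      using that a(2) T'_a unfolding supp_def by auto
    have "\<rho> w \<cdot> (f \<cdot> trunc (T' w)) \<in> Mor A P (N w)"
      by (rule cmp_mor[OF P_Obj S_Obj N_Obj f_trunc_mor coproj_mor]) (rule w)+
    from tests[OF w(1) this w(2)] obtain G e where G: "G \<in> \<G>" and e: "e \<in> Mor A G P"
      and ne: "(\<rho> w \<cdot> (f \<cdot> trunc (T' w))) \<cdot> e \<noteq> zero_mor A G (N w)" by blast
    have G_Obj: "G \<in> Obj A" using G \<G> by blast
    have "(\<rho> w \<cdot> (f \<cdot> trunc (T' w))) \<cdot> e = \<rho> w \<cdot> (f \<cdot> (trunc (T' w) \<cdot> e))"
      using cmp_assoc[OF G_Obj P_Obj S_Obj N_Obj[OF w(1)] e f_trunc_mor coproj_mor[OF w(1)]]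
        cmp_assoc[OF G_Obj P_Obj P_Obj S_Obj e trunc_mor f_mor]
      by simp
    then show ?thesis using ne G e w(1) unfolding supp_def by auto
  qed
  then obtain G g where G: "\<And>w. w \<in> ?W \<Longrightarrow> G w \<in> \<G>" and g: "\<And>w. w \<in> ?W \<Longrightarrow> g w \<in> Mor A (G w) P"
    and hump: "\<And>w. w \<in> ?W \<Longrightarrow> w \<in> supp_of (G w) (f \<cdot> (trunc (T' w) \<cdot> g w))"
    by metis
  obtain Q q where Q: "is_product A ?W G Q q" "\<And>h. h \<in> Mor A Q S \<Longrightarrow> finite (supp_of Q h)"
    using prods[OF W, of G] G by blast
  have "finite {w \<in> ?W. k \<in> T' w}" for k
  proof -
    have "{w \<in> ?W. k \<in> T' w} = a ` {n. k \<in> T n}" using T'_a by auto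
    then show ?thesis using T by simp
  qed
  then obtain h where h: "h \<in> Mor A Q P" "?W \<subseteq> supp_of Q (f \<cdot> h)"
    using gliding_hump[OF W Q(1) _ g _ hump] G \<G> by blast
  have "finite (supp_of Q (f \<cdot> h))"
    using Q(2) cmp_mor[OF product_Obj[OF Q(1)] P_Obj S_Obj h(1) f_mor] by blast
  then have "finite ?W" using h(2) finite_subset by blast
  then show False using a(1) finite_imageD by blast
qed

end

section \<open>Detection by generators, and compactness of the product\<close>

lemma (in preadditive_category) is_product_singleton:
  assumes "G \<in> Obj A"
  shows "is_product A {i} (\<lambda>_. G) G (\<lambda>_. ident A G)"
  unfolding is_product_def using assms ident_mor cmp_ident_left by auto

text \<open>If \<open>g\<close> vanished on every summand of a coproduct covering \<open>X\<close>,
  then \<open>g \<cdot> e\<close> would be zero and \<open>g\<close> would be zero since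
  \<open>e\<close> is epi. The small set \<open>{i}\<close> is returned because singletons need not
  be small when \<open>'u\<close> is tiny; here it lies in the small index set.\<close>

lemma (in preadditive_category) generates_nonzero:
  assumes gen: "generates TYPE('u) A \<G>" and \<G>: "\<G> \<subseteq> Obj A"
    and X: "X \<in> Obj A" and Y: "Y \<in> Obj A" and g: "g \<in> Mor A X Y" "g \<noteq> zero_mor A X Y"
  obtains G e i where "G \<in> \<G>" "e \<in> Mor A G X" "g \<cdot> e \<noteq> zero_mor A G Y" "small TYPE('u) {i :: 'u}"
proof -
  obtain I :: "'u set" and N S \<nu> e where I: "small TYPE('u) I" and N: "N \<in> I \<rightarrow> \<G>"
    and S: "is_coproduct A I N S \<nu>" and e: "is_epimorphism A S X e"
    using gen X unfolding generates_def by blast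
  have S_Obj: "S \<in> Obj A" and \<nu>: "\<And>i. i \<in> I \<Longrightarrow> \<nu> i \<in> Mor A (N i) S"
    using coproduct_Obj[OF S] coproduct_inj[OF S] by auto
  have N_Obj: "N i \<in> Obj A" if "i \<in> I" for i using that N \<G> by blast
  have e_mor: "e \<in> Mor A S X" using e unfolding is_epimorphism_def by blast
  have "\<exists>i \<in> I. g \<cdot> (e \<cdot> \<nu> i) \<noteq> zero_mor A (N i) Y"
  proof (rule ccontr)
    assume "\<not> ?thesis"
    then have zero: "g \<cdot> (e \<cdot> \<nu> i) = zero_mor A (N i) Y" if "i \<in> I" for i using that by blast
    have "g \<cdot> e = zero_mor A S Y"
    proof (rule coproduct_eqI[OF S Y _ _ N_Obj])
      fix i assume i: "i \<in> I"
      show "g \<cdot> e \<cdot> \<nu> i = zero_mor A S Y \<cdot> \<nu> i"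
        using cmp_assoc[OF N_Obj[OF i] S_Obj X Y \<nu>[OF i] e_mor g(1)]
          cmp_zero_left[OF N_Obj[OF i] S_Obj Y \<nu>[OF i]] zero[OF i] by simp
    qed (auto intro: cmp_mor[OF S_Obj X Y e_mor g(1)] zero_mor_closed[OF S_Obj Y])
    also have "\<dots> = zero_mor A X Y \<cdot> e" using cmp_zero_left[OF S_Obj X Y e_mor] by simp
    finally show False
      using e Y g zero_mor_closed[OF X Y] unfolding is_epimorphism_def by blast
  qed
  then obtain i where i: "i \<in> I" "g \<cdot> (e \<cdot> \<nu> i) \<noteq> zero_mor A (N i) Y" by blast
  have "small TYPE('u) {i}"
    using I i(1) card_of_mono1[of "{i}" I] ordLeq_ordLess_trans unfolding small_def by blast
  moreover have "e \<cdot> \<nu> i \<in> Mor A (N i) X" by (rule cmp_mor[OF N_Obj[OF i(1)] S_Obj X \<nu>[OF i(1)] e_mor])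
  ultimately show thesis using that[of "N i" "e \<cdot> \<nu> i" i] N i by blast
qed

theorem theorem3p4:
  fixes A :: "('o, 'm) hom_cat" and C :: "'o set"
  assumes "abelian_category A"
    and "has_small_products TYPE('u) A"
    and "has_small_coproducts TYPE('u) A"
    and "C \<subseteq> Obj A"
    and "prod_compactly_generated TYPE('u) A C"
    and "\<not> (\<exists>\<kappa> :: 'u rel. strongly_inaccessible \<kappa> \<and> small TYPE('u) (Field \<kappa>))"
  shows "\<forall>(I :: 'u set) M P \<pi>.
           small TYPE('u) I \<and> (\<forall>i \<in> I. compact_wrt TYPE('u) A C (M i)) \<and> is_product A I M P \<pi>
           \<longrightarrow> compact_wrt TYPE('u) A C P"
proof (intro allI impI, elim conjE)
  fix K :: "'u set" and M P \<pi>
  assume K: "small TYPE('u) K" and M: "\<forall>k \<in> K. compact_wrt TYPE('u) A C (M k)"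
    and P: "is_product A K M P \<pi>"
  interpret abelian_category A by fact
  obtain \<G> where \<G>: "\<G> \<subseteq> Obj A" "generates TYPE('u) A \<G>"
    and products: "\<forall>(I :: 'u set) N P \<pi>. small TYPE('u) I \<and> N \<in> I \<rightarrow> \<G> \<and> is_product A I N P \<pi>
      \<longrightarrow> compact_wrt TYPE('u) A C P"
    using assms(5) unfolding prod_compactly_generated_def by (elim exE conjE)
  have compact: "compact_wrt TYPE('u) A C P"
    if "small TYPE('u) I" "N \<in> I \<rightarrow> \<G>" "is_product A I N P \<pi>" for I :: "'u set" and N P \<pi>
    using products that by blast
  have P_Obj: "P \<in> Obj A" by (rule product_Obj[OF P])
  have "Psi A P I S \<nu> \<in> iso (sum_group I (\<lambda>i. Hom A P (N i))) (Hom A P S)"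
    if I: "small TYPE('u) I" and N: "N \<in> I \<rightarrow> C" and S: "is_coproduct A I N S \<nu>"
    for I :: "'u set" and N S \<nu>
  proof -
    interpret coproduct_in A I N S \<nu>
      by unfold_locales (use S N assms(4) in auto)
    have compact_iso: "X \<in> Obj A"
        "Psi A X I S \<nu> \<in> iso (sum_group I (\<lambda>i. Hom A X (N i))) (Hom A X S)"
      if "compact_wrt TYPE('u) A C X" for X
      using that I N S unfolding compact_wrt_def by auto
    show ?thesis
    proof (rule iso_if_finite_supp[OF P_Obj])
      fix f assume f: "f \<in> Mor A P S"
      interpret product_to_coproduct A I N S \<nu> K M P \<pi> f
        by unfold_locales (use P f M in \<open>auto simp: compact_wrt_def\<close>)
      interpret ideal: gliding_ideal K null
      proof
        show "{k} \<in> null" if "k \<in> K" for k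
          using that M by (intro null_singleton finite_supp_if_iso compact_iso) auto
        show "\<exists>n. T n \<in> null" if "\<And>k. finite {n :: nat. k \<in> T n}" for T
        proof (rule null_point_finite[OF that _ \<G>(1)])
          show "\<exists>G \<in> \<G>. \<exists>e \<in> Mor A G P. g \<cdot>\<^bsub>A\<^esub> e \<noteq> zero_mor A G (N i)"
            if "i \<in> I" "g \<in> Mor A P (N i)" "g \<noteq> zero_mor A P (N i)" for i g
            using generates_nonzero[OF \<G>(2,1) P_Obj N_Obj that(2,3)] that(1) by metis
          show "\<exists>Q q. is_product A W G Q q \<and> (\<forall>h \<in> Mor A Q S. finite (supp_of Q h))"
            if W: "W \<subseteq> I" and G: "G \<in> W \<rightarrow> \<G>" for W G
          proof -
            have sW: "small TYPE('u) W"
              using I card_of_mono1[OF W] ordLeq_ordLess_trans unfolding small_def by blast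
            moreover have "G \<in> W \<rightarrow> Obj A" using G \<G>(1) by blast
            ultimately obtain Q q where Q: "is_product A W G Q q"
              using assms(2) unfolding has_small_products_def by blast
            have "compact_wrt TYPE('u) A C Q" by (rule compact[OF sW G Q])
            then show ?thesis using Q finite_supp_if_iso compact_iso by blast
          qed
        qed
      qed (auto intro: null_subset null_Un)
      \<comment> \<open>Otherwise there is a strongly inaccessible cardinal of size at most
        \<open>|K|\<close>, which lies below the size of \<open>'u\<close> and is therefore
        excluded. Since \<open>trunc K\<close> is the identity, \<open>K\<close> being null means
        that \<open>f\<close> itself has finite support.\<close>
      have "K \<in> null"
      proof (rule ccontr)
        assume "K \<notin> null"
        then obtain \<kappa> :: "'u rel" where \<kappa>: "strongly_inaccessible \<kappa>" "\<kappa> \<le>o |K|"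
          using ideal.strongly_inaccessible_exists by blast
        then have "|Field \<kappa>| =o \<kappa>"
          using card_of_Field_ordIso unfolding strongly_inaccessible_def by blast
        then have "|Field \<kappa>| <o |UNIV :: 'u set|"
          using \<kappa>(2) K ordIso_ordLeq_trans ordLeq_ordLess_trans unfolding small_def by blast
        then show False using assms(6) \<kappa>(1) unfolding small_def by blast
      qed
      then have "finite (supp_of P (f \<cdot>\<^bsub>A\<^esub> ident A P))"
        unfolding null_def trunc_all[symmetric] by simp
      then show "finite (supp_of P f)" unfolding cmp_ident_right[OF P_Obj S_Obj f] .
    next
      fix f assume f: "f \<in> Mor A P S" "supp_of P f = {}"
      show "f = zero_mor A P S"
      proof (rule ccontr)
        assume "f \<noteq> zero_mor A P S"
        \<comment> \<open>A nonzero \<open>f\<close> stays nonzero on some generator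
          \<open>G\<close>. As the product of a one-member family, \<open>G\<close> is compact, so
          the empty support of \<open>f \<cdot> e\<close> forces this composite to vanish.\<close>
        from generates_nonzero[OF \<G>(2,1) P_Obj S_Obj f(1) this]
        obtain G e and i :: 'u where G: "G \<in> \<G>" and e: "e \<in> Mor A G P"
          and ne: "f \<cdot>\<^bsub>A\<^esub> e \<noteq> zero_mor A G S" and i: "small TYPE('u) {i}" by blast
        have "G \<in> Obj A" using G \<G>(1) by blast
        then have "compact_wrt TYPE('u) A C G"
          using compact[OF i _ is_product_singleton] G by blast
        from zero_if_supp_empty[OF compact_iso[OF this]]
        show False
          using ne cmp_mor[OF \<open>G \<in> Obj A\<close> P_Obj S_Obj e f(1)]
            supp_cmp_subset[OF \<open>G \<in> Obj A\<close> P_Obj f(1) e] f(2) by blast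
      qed
    qed
  qed
  then show "compact_wrt TYPE('u) A C P"
    using P_Obj unfolding compact_wrt_def by blast
qed

end
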